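(* For every integer $k>4$, the graph $C_k^{\bowtie}$ is not weakly norming, where $C_k$ denotes the cycle of length $k$.
   Context: For a graph $H$, the graph $H^{\bowtie}$ is obtained by replacing every vertex $v$ of $H$ by an edge $v_1v_2$ (on two new vertices $v_1,v_2$), and, for every edge $uv\in E(H)$, adding the two edges $u_1v_2$ and $u_2v_1$ (and no others). Let $\mathcal{W}$ be the real vector space of symmetric bounded measurable functions $W:[0,1]^2\to\mathbb{R}$. For a graph $H$ and $W\in\mathcal{W}$, the homomorphism density is $t_H(W)=\int_{[0,1]^{V(H)}}\prod_{ij\in E(H)}W(x_i,x_j)\,d\mu^{v(H)}$, where $\mu$ is Lebesgue measure. Set $\|W\|_{r(H)}:=t_H(|W|)^{1/e(H)}$. A graph $H$ is called weakly norming if $\|\cdot\|_{r(H)}$ is a norm on $\mathcal{W}$. *)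

theory Defs
  imports "HOL-Analysis.Analysis"
begin

type_synonym 'a ugraph = "'a set \<times> 'a set set"

abbreviation verts :: "'a ugraph \<Rightarrow> 'a set" where "verts \<equiv> fst"
abbreviation edges :: "'a ugraph \<Rightarrow> 'a set set" where "edges \<equiv> snd"

definition simple_graph :: "'a ugraph \<Rightarrow> bool" where
  "simple_graph H \<longleftrightarrow> finite (verts H) \<and> (\<forall>e\<in>edges H. e \<subseteq> verts H \<and> card e = 2)"

definition cycle_graph :: "nat \<Rightarrow> nat ugraph" where
  "cycle_graph k = ({..<k}, {{i, (i + 1) mod k} | i. i < k})"

text \<open>The vertices \<open>(v, 1)\<close> and \<open>(v, 2)\<close> are the two copies of \<open>v\<close>. Since \<open>{u, v}\<close> is unordered,
  the second comprehension contributes both cross edges of every edge of \<open>H\<close>.\<close>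

definition bowtie :: "'a ugraph \<Rightarrow> ('a \<times> nat) ugraph" where
  "bowtie H = (verts H \<times> {1, 2},
     {{(v, 1), (v, 2)} | v. v \<in> verts H} \<union> {{(u, 1), (v, 2)} | u v. {u, v} \<in> edges H})"

lemma simple_graph_cycle_graph:
  assumes "k \<ge> 3"
  shows "simple_graph (cycle_graph k)"
proof -
  have "i \<noteq> Suc i mod k" if "i < k" for i
    using that assms by (cases "Suc i = k") auto
  then show ?thesis
    using assms by (auto simp: simple_graph_def cycle_graph_def)
qed

lemma simple_graph_bowtie:
  assumes "simple_graph H"
  shows "simple_graph (bowtie H)"
  using assms by (fastforce simp: simple_graph_def bowtie_def)

text \<open>Symmetric bounded Lebesgue measurable functions on the unit square; values outside the
  square are irrelevant.\<close>

definition kernels :: "(real \<times> real \<Rightarrow> real) set" where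
  "kernels = {W. W \<in> borel_measurable (lebesgue_on ({0..1} \<times> {0..1})) \<and>
                 bounded (W ` ({0..1} \<times> {0..1})) \<and>
                 (\<forall>x\<in>{0..1}. \<forall>y\<in>{0..1}. W (x, y) = W (y, x))}"

text \<open>The value \<open>W (x i, x j)\<close> for an unordered edge \<open>e = {i, j}\<close>; the set is a singleton
  whenever \<open>W\<close> is symmetric.\<close>

definition edge_val :: "(real \<times> real \<Rightarrow> real) \<Rightarrow> ('a \<Rightarrow> real) \<Rightarrow> 'a set \<Rightarrow> real" where
  "edge_val W x e = the_elem {W (x i, x j) | i j. e = {i, j}}"

lemma edge_val_doubleton:
  assumes "W (x i, x j) = W (x j, x i)"
  shows "edge_val W x {i, j} = W (x i, x j)"
proof -
  have "{W (x a, x b) | a b. {i, j} = {a, b}} = {W (x i, x j)}"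
    using assms by (auto simp: doubleton_eq_iff)
  then show ?thesis by (simp add: edge_val_def)
qed

text \<open>Lebesgue measure on the cube is the completion of the product of the Borel measures. The
  completion matters: for a Lebesgue measurable \<open>W\<close> the integrand need not be measurable with
  respect to the product sigma-algebra, and the Bochner integral would then default to 0.\<close>

definition hom_density :: "'a ugraph \<Rightarrow> (real \<times> real \<Rightarrow> real) \<Rightarrow> real" where
  "hom_density H W =
     (LINT x | completion (\<Pi>\<^sub>M i\<in>verts H. restrict_space lborel {0..1}).
        (\<Prod>e\<in>edges H. edge_val W x e))"

definition r_norm :: "'a ugraph \<Rightarrow> (real \<times> real \<Rightarrow> real) \<Rightarrow> real" where
  "r_norm H W = hom_density H (\<lambda>z. \<bar>W z\<bar>) powr (1 / real (card (edges H)))"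

text \<open>As for the \<open>L\<^sup>p\<close> norms, functions agreeing almost everywhere are identified, so definiteness
  is an almost-everywhere statement; asking for pointwise definiteness would make every such
  functional fail to be a norm.\<close>

definition norm_on_kernels :: "((real \<times> real \<Rightarrow> real) \<Rightarrow> real) \<Rightarrow> bool" where
  "norm_on_kernels N \<longleftrightarrow>
     (\<forall>U\<in>kernels. N U \<ge> 0) \<and>
     (\<forall>U\<in>kernels. N U = 0 \<longleftrightarrow> (AE z in lebesgue_on ({0..1} \<times> {0..1}). U z = 0)) \<and>
     (\<forall>c. \<forall>U\<in>kernels. N (\<lambda>z. c * U z) = \<bar>c\<bar> * N U) \<and>
     (\<forall>U\<in>kernels. \<forall>W\<in>kernels. N (\<lambda>z. U z + W z) \<le> N U + N W)"

definition weakly_norming :: "'a ugraph \<Rightarrow> bool" where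
  "weakly_norming H \<longleftrightarrow> norm_on_kernels (r_norm H)"

end

theory Submission
  imports Defs
begin

text \<open>A weakly norming functional satisfies a Hoelder inequality: by tensor powers, decorating a
  set \<open>R\<close> of edges of \<open>H\<close> with one nonnegative kernel and the remaining edges with another gives a
  density of at most the geometric mean of the two pure densities, weighted by the numbers of edges.
  For kernels \<open>1 + c r(x) r(y)\<close> with a random sign \<open>r\<close>, the density is the generating function of the
  even edge sets of \<open>H\<close>. For \<open>k > 4\<close> the smallest nonempty even edge sets of \<open>C\<^sub>k\<^sup>\<bowtie>\<close> are \<open>k\<close> squares,
  each with two rungs (edges \<open>v\<^sub>1v\<^sub>2\<close>) and two other edges, although only a third of all edges are
  rungs. With \<open>c = a\<close> on the rungs and \<open>c = b\<close> elsewhere, the inequality becomes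
  \<open>3 a\<^sup>2 b\<^sup>2 \<le> a\<^sup>4 + 2 b\<^sup>4\<close> to leading order, which fails for \<open>a : b = 4 : 3\<close>.\<close>

section \<open>Densities of step kernels\<close>

text \<open>Since \<open>p\<close> takes finitely many values, the integrand is a finite combination
  of products of one-variable indicators; each term integrates factor by factor.\<close>

lemma integral_PiM_finite_range:
  fixes G :: "('a \<Rightarrow> 'i) \<Rightarrow> real"
  assumes "finite_measure M" "finite V" "finite I" and p: "p \<in> M \<rightarrow>\<^sub>M count_space I"
  shows "(\<lambda>x. G (\<lambda>v\<in>V. p (x v))) \<in> borel_measurable (PiM V (\<lambda>_. M))"
    and "(LINT x | PiM V (\<lambda>_. M). G (\<lambda>v\<in>V. p (x v)))
       = (\<Sum>\<phi>\<in>PiE V (\<lambda>_. I). G \<phi> * (\<Prod>v\<in>V. measure M {y\<in>space M. p y = \<phi> v}))"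
proof -
  interpret finite_measure M by fact
  interpret product_sigma_finite "\<lambda>_. M"
    by unfold_locales
  let ?f = "\<lambda>i y. indicator {y\<in>space M. p y = i} y :: real"
  let ?g = "\<lambda>x. \<Sum>\<phi>\<in>PiE V (\<lambda>_. I). G \<phi> * (\<Prod>v\<in>V. ?f (\<phi> v) (x v))"
  have sets: "{y\<in>space M. p y = i} \<in> sets M" if "i \<in> I" for i
    using measurable_sets[OF p, of "{i}"] that by (simp add: vimage_def Int_def conj_commute)
  have int: "integrable M (?f i)" if "i \<in> I" for i
    using sets[OF that] by (simp add: emeasure_eq_measure)
  \<comment> \<open>At each point exactly one labelling has a nonzero product of indicators, the one
    read off from the point.\<close>
  have eq: "G (\<lambda>v\<in>V. p (x v)) = ?g x" if x: "x \<in> space (PiM V (\<lambda>_. M))" for x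
  proof -
    let ?\<psi> = "\<lambda>v\<in>V. p (x v)"
    have xv: "x v \<in> space M" if "v \<in> V" for v
      using x that by (auto simp: space_PiM)
    have \<psi>: "?\<psi> \<in> PiE V (\<lambda>_. I)"
      using measurable_space[OF p] xv by auto
    have "(\<Prod>v\<in>V. ?f (\<phi> v) (x v)) = (if \<phi> = ?\<psi> then 1 else 0)" if \<phi>: "\<phi> \<in> PiE V (\<lambda>_. I)" for \<phi>
    proof (cases "\<phi> = ?\<psi>")
      case True
      then show ?thesis by (simp add: xv)
    next
      case False
      then obtain v where "v \<in> V" "\<phi> v \<noteq> ?\<psi> v"
        using PiE_ext[OF \<phi> \<psi>] by blast
      then have "\<exists>v\<in>V. ?f (\<phi> v) (x v) = 0"
        by (intro bexI[of _ v]) auto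
      then have "(\<Prod>v\<in>V. ?f (\<phi> v) (x v)) = 0"
        using \<open>finite V\<close> by (intro prod_zero)
      then show ?thesis using False by simp
    qed
    then have "?g x = (\<Sum>\<phi>\<in>PiE V (\<lambda>_. I). if \<phi> = ?\<psi> then G \<phi> else 0)"
      by (intro sum.cong) auto
    also have "\<dots> = G ?\<psi>"
      using \<psi> assms by (simp add: finite_PiE)
    finally show ?thesis by simp
  qed
  have intg: "integrable (PiM V (\<lambda>_. M)) (\<lambda>x. \<Prod>v\<in>V. ?f (\<phi> v) (x v))" if "\<phi> \<in> PiE V (\<lambda>_. I)" for \<phi>
    using that \<open>finite V\<close> by (intro product_integrable_prod int) auto
  have "integrable (PiM V (\<lambda>_. M)) ?g"
    using intg by (intro Bochner_Integration.integrable_sum integrable_mult_right) auto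
  then have "?g \<in> borel_measurable (PiM V (\<lambda>_. M))"
    by (rule borel_measurable_integrable)
  then show "(\<lambda>x. G (\<lambda>v\<in>V. p (x v))) \<in> borel_measurable (PiM V (\<lambda>_. M))"
    by (subst measurable_cong[OF eq])
  have "(LINT x | PiM V (\<lambda>_. M). G (\<lambda>v\<in>V. p (x v))) = (LINT x | PiM V (\<lambda>_. M). ?g x)"
    by (intro Bochner_Integration.integral_cong eq) auto
  also have "\<dots> = (\<Sum>\<phi>\<in>PiE V (\<lambda>_. I). G \<phi> * (LINT x | PiM V (\<lambda>_. M). (\<Prod>v\<in>V. ?f (\<phi> v) (x v))))"
    using intg by (subst Bochner_Integration.integral_sum) auto
  also have "\<dots> = (\<Sum>\<phi>\<in>PiE V (\<lambda>_. I). G \<phi> * (\<Prod>v\<in>V. measure M {y\<in>space M. p y = \<phi> v}))"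
  proof (intro sum.cong refl arg_cong2[where f = "(*)"])
    fix \<phi> assume \<phi>: "\<phi> \<in> PiE V (\<lambda>_. I)"
    have "(LINT x | PiM V (\<lambda>_. M). (\<Prod>v\<in>V. ?f (\<phi> v) (x v))) = (\<Prod>v\<in>V. LINT y | M. ?f (\<phi> v) y)"
      using \<phi> \<open>finite V\<close> by (intro product_integral_prod int) auto
    also have "\<dots> = (\<Prod>v\<in>V. measure M {y\<in>space M. p y = \<phi> v})"
      using \<phi> sets by (intro prod.cong refl) (auto simp: PiE_iff Int_absorb2)
    finally show "(LINT x | PiM V (\<lambda>_. M). (\<Prod>v\<in>V. ?f (\<phi> v) (x v))) = \<dots>" .
  qed
  finally show "(LINT x | PiM V (\<lambda>_. M). G (\<lambda>v\<in>V. p (x v)))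
       = (\<Sum>\<phi>\<in>PiE V (\<lambda>_. I). G \<phi> * (\<Prod>v\<in>V. measure M {y\<in>space M. p y = \<phi> v}))" .
qed

text \<open>Cut the unit interval into \<open>card I\<close> pieces of equal length, one per
  element. Integrals of step kernels thereby become uniform averages over \<open>I\<close>.\<close>

lemma uniform_map_exists:
  assumes "finite I" "I \<noteq> {}"
  shows "\<exists>p :: real \<Rightarrow> 'i. range p \<subseteq> I \<and> p \<in> borel \<rightarrow>\<^sub>M count_space I \<and>
    (\<forall>i\<in>I. measure lborel {x\<in>{0..1}. p x = i} = 1 / card I)"
proof -
  define m where "m = card I"
  have m: "m > 0" using assms by (simp add: m_def card_gt_0_iff)
  obtain h where h: "bij_betw h {0..<m} I"
    using ex_bij_betw_nat_finite[OF assms(1)] m_def by blast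
  \<comment> \<open>The \<open>min\<close> puts the right end point 1 into the last piece, and
    \<open>nat\<close> sends negative arguments to 0, so \<open>q\<close> stays below
    \<open>m\<close> on all reals.\<close>
  define q where "q x = min (m - 1) (nat \<lfloor>real m * x\<rfloor>)" for x
  have q: "q x < m" for x using m by (simp add: q_def)
  have qm: "q \<in> borel \<rightarrow>\<^sub>M count_space {0..<m}"
  proof -
    have "q \<in> borel \<rightarrow>\<^sub>M count_space UNIV" unfolding q_def by measurable
    then show ?thesis using q by (auto simp: measurable_def)
  qed
  have hm: "h \<in> count_space {0..<m} \<rightarrow>\<^sub>M count_space I"
    using h by (auto simp: bij_betw_def)
  have "measure lborel {x\<in>{0..1}. h (q x) = i} = 1 / card I" if i: "i \<in> I" for i
  proof -
    obtain j where j: "j < m" "h j = i" using h i by (auto simp: bij_betw_def)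
    have "h (q x) = i \<longleftrightarrow> q x = j" for x
      using h q[of x] j by (auto simp: bij_betw_def inj_on_def)
    moreover have "q x = j \<longleftrightarrow> (if j = m - 1 then real j / m \<le> x else real j / m \<le> x \<and> x < (real j + 1) / m)"
      if "x \<in> {0..1}" for x
    proof -
      have "nat \<lfloor>real m * x\<rfloor> = j \<longleftrightarrow> real j / m \<le> x \<and> x < (real j + 1) / m"
        using that m by (auto simp: nat_eq_iff floor_eq_iff field_simps)
      moreover have "m - 1 \<le> nat \<lfloor>real m * x\<rfloor> \<longleftrightarrow> real (m - 1) / m \<le> x"
        using that m by (auto simp: le_nat_iff le_floor_iff field_simps)
      ultimately show ?thesis using j(1) by (auto simp: q_def min_def)
    qed
    ultimately have "{x\<in>{0..1}. h (q x) = i} = {x\<in>{0..1}. if j = m - 1 then real j / m \<le> x else real j / m \<le> x \<and> x < (real j + 1) / m}"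
      by (intro Collect_cong conj_cong refl) presburger
    also have "\<dots> = (if j = m - 1 then {real j / m..1} else {real j / m..<(real j + 1) / m})"
    proof -
      have "(real j + 1) / m \<le> 1" using j m by (simp add: field_simps)
      then show ?thesis
        by (auto intro: order_trans[OF divide_nonneg_nonneg[OF of_nat_0_le_iff of_nat_0_le_iff]])
    qed
    also have "measure lborel \<dots> = 1 / m"
      using j m by (auto simp: field_simps of_nat_diff divide_simps)
    finally show ?thesis by (simp add: m_def)
  qed
  moreover have "range (\<lambda>x. h (q x)) \<subseteq> I" using h q by (auto simp: bij_betw_def)
  ultimately show ?thesis
    using measurable_compose[OF qm hm] by (intro exI[of _ "\<lambda>x. h (q x)"]) simp
qed

section \<open>Spin averages and even edge sets\<close>

text \<open>With edge sets read as vectors over GF(2), this is the cycle space of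
  \<open>H\<close>.\<close>

definition even_edge_sets :: "'a ugraph \<Rightarrow> 'a set set set" where
  "even_edge_sets H = {F. F \<subseteq> edges H \<and> (\<forall>v\<in>verts H. even (card {e\<in>F. v \<in> e}))}"

text \<open>The expectation over independent fair signs at the vertices. Up to normalisation this is
  an Ising partition function in which \<open>c e\<close> is the hyperbolic tangent of the coupling
  of \<open>e\<close>.\<close>

definition spin_average :: "'a ugraph \<Rightarrow> ('a set \<Rightarrow> real) \<Rightarrow> real" where
  "spin_average H c =
     (\<Sum>s\<in>PiE (verts H) (\<lambda>_. {-1, 1}). \<Prod>e\<in>edges H. 1 + c e * (\<Prod>v\<in>e. s v)) / 2 ^ card (verts H)"

lemma simple_graph_finite:
  assumes "simple_graph H"
  shows "finite (verts H)" "finite (edges H)"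
proof -
  show fin: "finite (verts H)" using assms by (simp add: simple_graph_def)
  have "edges H \<subseteq> Pow (verts H)" using assms by (auto simp: simple_graph_def)
  then show "finite (edges H)" using fin by (meson finite_Pow_iff finite_subset)
qed

text \<open>Collected by vertices, the sign at \<open>v\<close> gets the degree of \<open>v\<close>
  in \<open>F\<close> as exponent; its two values add up to 2 for an even degree and cancel for an
  odd one.\<close>

lemma sum_signs_edge_products:
  assumes "simple_graph H" "F \<subseteq> edges H"
  shows "(\<Sum>s\<in>PiE (verts H) (\<lambda>_. {-1, 1 :: real}). \<Prod>e\<in>F. \<Prod>v\<in>e. s v)
       = (if F \<in> even_edge_sets H then 2 ^ card (verts H) else 0)"
proof -
  let ?V = "verts H" and ?d = "\<lambda>v. card {e\<in>F. v \<in> e}"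
  have fin: "finite ?V" "finite F"
    using simple_graph_finite[OF assms(1)] assms(2) finite_subset by auto
  have "(\<Prod>e\<in>F. \<Prod>v\<in>e. s v) = (\<Prod>v\<in>?V. s v ^ ?d v)" for s :: "'a \<Rightarrow> real"
  proof -
    have "(\<Prod>e\<in>F. \<Prod>v\<in>e. s v) = (\<Prod>e\<in>F. \<Prod>v\<in>?V. if v \<in> e then s v else 1)"
    proof (rule prod.cong[OF refl])
      fix e assume "e \<in> F"
      then have "e \<subseteq> ?V" using assms by (auto simp: simple_graph_def)
      then show "(\<Prod>v\<in>e. s v) = (\<Prod>v\<in>?V. if v \<in> e then s v else 1)"
        using fin by (simp add: prod.If_cases Int_absorb1)
    qed
    also have "\<dots> = (\<Prod>v\<in>?V. \<Prod>e\<in>F. if v \<in> e then s v else 1)"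
      by (rule prod.swap)
    also have "\<dots> = (\<Prod>v\<in>?V. s v ^ ?d v)"
      using fin by (simp add: prod.If_cases Int_def conj_commute)
    finally show ?thesis .
  qed
  then have "(\<Sum>s\<in>PiE ?V (\<lambda>_. {-1, 1 :: real}). \<Prod>e\<in>F. \<Prod>v\<in>e. s v)
      = (\<Sum>s\<in>PiE ?V (\<lambda>_. {-1, 1 :: real}). \<Prod>v\<in>?V. s v ^ ?d v)"
    by simp
  also have "\<dots> = (\<Prod>v\<in>?V. \<Sum>t\<in>{-1, 1 :: real}. t ^ ?d v)"
    using fin by (subst prod_sum_PiE) auto
  also have "\<dots> = (\<Prod>v\<in>?V. if even (?d v) then 2 else 0)"
    by (intro prod.cong) auto
  also have "\<dots> = (if F \<in> even_edge_sets H then 2 ^ card ?V else 0)"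
    using fin assms(2) by (auto simp: even_edge_sets_def)
  finally show ?thesis .
qed

text \<open>Expanding the product over edges gives one term per edge set, and averaging over signs
  kills all but the even ones (the high-temperature expansion).\<close>

lemma spin_average_eq_sum_even_edge_sets:
  assumes "simple_graph H"
  shows "spin_average H c = (\<Sum>F\<in>even_edge_sets H. \<Prod>e\<in>F. c e)"
proof -
  let ?V = "verts H" and ?E = "edges H" and ?S = "PiE (verts H) (\<lambda>_. {-1, 1 :: real})"
  have fin: "finite ?E" using simple_graph_finite[OF assms] by simp
  have "(\<Sum>s\<in>?S. \<Prod>e\<in>?E. 1 + c e * (\<Prod>v\<in>e. s v))
      = (\<Sum>s\<in>?S. \<Sum>F\<in>Pow ?E. (\<Prod>e\<in>F. c e) * (\<Prod>e\<in>F. \<Prod>v\<in>e. s v))"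
    using prod_add[OF fin, of "\<lambda>e. c e * (\<Prod>v\<in>e. s v)" "\<lambda>_. 1" for s]
    by (simp add: add.commute prod.distrib)
  also have "\<dots> = (\<Sum>F\<in>Pow ?E. (\<Prod>e\<in>F. c e) * (\<Sum>s\<in>?S. \<Prod>e\<in>F. \<Prod>v\<in>e. s v))"
    by (subst sum.swap) (simp add: sum_distrib_left)
  also have "\<dots> = (\<Sum>F\<in>Pow ?E. if F \<in> even_edge_sets H then (\<Prod>e\<in>F. c e) * 2 ^ card ?V else 0)"
    by (intro sum.cong refl) (simp add: sum_signs_edge_products[OF assms])
  also have "\<dots> = (\<Sum>F\<in>even_edge_sets H. (\<Prod>e\<in>F. c e) * 2 ^ card ?V)"
  proof -
    have "Pow ?E \<inter> even_edge_sets H = even_edge_sets H"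
      by (auto simp: even_edge_sets_def)
    then show ?thesis using fin by (simp add: sum.inter_restrict[symmetric])
  qed
  finally show ?thesis by (simp add: spin_average_def sum_distrib_right[symmetric])
qed

text \<open>A product of signs has absolute value 1, so every factor is positive. This licenses the
  later divisions and roots.\<close>

lemma spin_average_pos:
  assumes "simple_graph H" "\<And>e. e \<in> edges H \<Longrightarrow> \<bar>c e\<bar> < 1"
  shows "spin_average H c > 0"
proof -
  have "1 + c e * (\<Prod>v\<in>e. s v) > 0"
    if s: "s \<in> PiE (verts H) (\<lambda>_. {-1, 1})" and e: "e \<in> edges H" for s e
  proof -
    have "\<bar>s v\<bar> = 1" if "v \<in> e" for v
    proof -
      have "v \<in> verts H" using assms(1) e that by (auto simp: simple_graph_def)
      then have "s v \<in> {-1, 1}" using s by blast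
      then show ?thesis by auto
    qed
    then have "\<bar>c e * (\<Prod>v\<in>e. s v)\<bar> = \<bar>c e\<bar>" by (simp add: abs_mult abs_prod)
    then show ?thesis using assms(2)[OF e] by linarith
  qed
  then show ?thesis
    unfolding spin_average_def
    using simple_graph_finite[OF assms(1)]
    by (intro divide_pos_pos sum_pos prod_pos) (auto simp: PiE_eq_empty_iff finite_PiE)
qed

text \<open>Transposition identifies maps from \<open>V\<close> to vectors over \<open>J\<close>
  with \<open>J\<close>-indexed families of maps on \<open>V\<close>. This turns a tensor power of a
  kernel into a power of its density.\<close>

lemma sum_PiE_prod_power:
  fixes g :: "('a \<Rightarrow> 'b) \<Rightarrow> real"
  assumes "finite V" "finite J" "finite S"
  shows "(\<Sum>\<phi>\<in>PiE V (\<lambda>_. PiE J (\<lambda>_. S)). \<Prod>j\<in>J. g (\<lambda>v\<in>V. \<phi> v j))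
       = (\<Sum>s\<in>PiE V (\<lambda>_. S). g s) ^ card J"
proof -
  have "(\<Sum>s\<in>PiE V (\<lambda>_. S). g s) ^ card J = (\<Prod>j\<in>J. \<Sum>s\<in>PiE V (\<lambda>_. S). g s)"
    by simp
  also have "\<dots> = (\<Sum>\<psi>\<in>PiE J (\<lambda>_. PiE V (\<lambda>_. S)). \<Prod>j\<in>J. g (\<psi> j))"
    using assms by (intro prod_sum_PiE) (auto simp: finite_PiE)
  also have "\<dots> = (\<Sum>\<phi>\<in>PiE V (\<lambda>_. PiE J (\<lambda>_. S)). \<Prod>j\<in>J. g (\<lambda>v\<in>V. \<phi> v j))"
  proof (rule sum.reindex_bij_witness
      [where j = "\<lambda>\<psi>. \<lambda>v\<in>V. \<lambda>j\<in>J. \<psi> j v" and i = "\<lambda>\<phi>. \<lambda>j\<in>J. \<lambda>v\<in>V. \<phi> v j"])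
    fix \<psi> assume \<psi>: "\<psi> \<in> PiE J (\<lambda>_. PiE V (\<lambda>_. S))"
    have eq: "(\<lambda>v\<in>V. \<psi> j v) = \<psi> j" if "j \<in> J" for j
      using \<psi> that by (intro PiE_restrict[of _ _ "\<lambda>_. S"]) auto
    show "(\<lambda>j\<in>J. \<lambda>v\<in>V. (\<lambda>v\<in>V. \<lambda>j\<in>J. \<psi> j v) v j) = \<psi>"
      using \<psi> eq by (intro PiE_ext[of _ J "\<lambda>_. PiE V (\<lambda>_. S)"]) (auto cong: restrict_cong)
    show "(\<lambda>v\<in>V. \<lambda>j\<in>J. \<psi> j v) \<in> PiE V (\<lambda>_. PiE J (\<lambda>_. S))"
      using \<psi> by fastforce
    show "(\<Prod>j\<in>J. g (\<lambda>v\<in>V. (\<lambda>v\<in>V. \<lambda>j\<in>J. \<psi> j v) v j)) = (\<Prod>j\<in>J. g (\<psi> j))"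
      using eq by (intro prod.cong refl) (simp cong: restrict_cong)
  next
    fix \<phi> assume \<phi>: "\<phi> \<in> PiE V (\<lambda>_. PiE J (\<lambda>_. S))"
    have eq: "(\<lambda>j\<in>J. \<phi> v j) = \<phi> v" if "v \<in> V" for v
      using \<phi> that by (intro PiE_restrict[of _ _ "\<lambda>_. S"]) auto
    show "(\<lambda>v\<in>V. \<lambda>j\<in>J. (\<lambda>j\<in>J. \<lambda>v\<in>V. \<phi> v j) j v) = \<phi>"
      using \<phi> eq by (intro PiE_ext[of _ V "\<lambda>_. PiE J (\<lambda>_. S)"]) (auto cong: restrict_cong)
    show "(\<lambda>j\<in>J. \<lambda>v\<in>V. \<phi> v j) \<in> PiE J (\<lambda>_. PiE V (\<lambda>_. S))"
      using \<phi> by fastforce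
  qed
  finally show ?thesis by simp
qed

section \<open>The Hoelder inequality for weakly norming graphs\<close>

text \<open>The kernel sees a pair only through its coordinatewise product, which is symmetric, so
  its value on an unordered edge is well defined.\<close>

lemma edge_val_coordinatewise:
  assumes "card e = 2"
  shows "edge_val (\<lambda>(x, y). Q (\<lambda>j. p x j * p y j)) x e = Q (\<lambda>j. \<Prod>v\<in>e. p (x v) j :: real)"
proof -
  obtain u v where e: "e = {u, v}" "u \<noteq> v" using assms by (auto simp: card_2_iff)
  then show ?thesis by (subst e(1), subst edge_val_doubleton) (auto simp: mult.commute)
qed

text \<open>The integrand depends only on the labels \<open>p (x v)\<close>, which are independent
  and uniform on \<open>I\<close>, so the integral is an average over labellings.\<close>

lemma hom_density_coordinatewise:
  fixes p :: "real \<Rightarrow> nat \<Rightarrow> real"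
  assumes H: "simple_graph H" and I: "finite I" and p: "p \<in> borel \<rightarrow>\<^sub>M count_space I"
    and unif: "\<And>i. i \<in> I \<Longrightarrow> measure lborel {x\<in>{0..1}. p x = i} = 1 / card I"
  shows "hom_density H (\<lambda>(x, y). Q (\<lambda>j. p x j * p y j))
       = (\<Sum>\<phi>\<in>PiE (verts H) (\<lambda>_. I). \<Prod>e\<in>edges H. Q (\<lambda>j. \<Prod>v\<in>e. \<phi> v j)) / card I ^ card (verts H)"
proof -
  let ?V = "verts H" and ?M = "restrict_space lborel {0..1::real}"
  define G where "G \<phi> = (\<Prod>e\<in>edges H. Q (\<lambda>j. \<Prod>v\<in>e. \<phi> v j))" for \<phi> :: "'a \<Rightarrow> nat \<Rightarrow> real"
  have fin: "finite ?V" using simple_graph_finite[OF H] by simp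
  have M: "finite_measure ?M"
    by (intro finite_measureI) (simp add: emeasure_restrict_space space_restrict_space)
  have pM: "p \<in> ?M \<rightarrow>\<^sub>M count_space I"
    using p by (intro measurable_restrict_space1) simp
  have integrand: "(\<Prod>e\<in>edges H. edge_val (\<lambda>(x, y). Q (\<lambda>j. p x j * p y j)) x e) = G (\<lambda>v\<in>?V. p (x v))"
    for x :: "'a \<Rightarrow> real"
    unfolding G_def
  proof (rule prod.cong[OF refl])
    fix e assume e: "e \<in> edges H"
    then have "card e = 2" "e \<subseteq> ?V" using H by (auto simp: simple_graph_def)
    moreover from this have "(\<Prod>v\<in>e. (\<lambda>v\<in>?V. p (x v)) v j) = (\<Prod>v\<in>e. p (x v) j)" for j
      by (intro prod.cong) auto
    ultimately show "edge_val (\<lambda>(x, y). Q (\<lambda>j. p x j * p y j)) x e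
        = Q (\<lambda>j. \<Prod>v\<in>e. (\<lambda>v\<in>?V. p (x v)) v j)"
      by (simp only: edge_val_coordinatewise)
  qed
  have meas: "measure ?M {y\<in>space ?M. p y = i} = 1 / card I" if "i \<in> I" for i
    using unif[OF that] by (subst measure_restrict_space) (auto simp: space_restrict_space)
  have "hom_density H (\<lambda>(x, y). Q (\<lambda>j. p x j * p y j))
      = (LINT x | PiM ?V (\<lambda>_. ?M). G (\<lambda>v\<in>?V. p (x v)))"
    unfolding hom_density_def integrand
    by (intro integral_completion integral_PiM_finite_range[OF M fin I pM])
  also have "\<dots> = (\<Sum>\<phi>\<in>PiE ?V (\<lambda>_. I). G \<phi> * (\<Prod>v\<in>?V. measure ?M {y\<in>space ?M. p y = \<phi> v}))"
    by (rule integral_PiM_finite_range[OF M fin I pM])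
  also have "\<dots> = (\<Sum>\<phi>\<in>PiE ?V (\<lambda>_. I). G \<phi> / card I ^ card ?V)"
  proof (rule sum.cong[OF refl])
    fix \<phi> assume "\<phi> \<in> PiE ?V (\<lambda>_. I)"
    then have "(\<Prod>v\<in>?V. measure ?M {y\<in>space ?M. p y = \<phi> v}) = (\<Prod>v\<in>?V. 1 / card I)"
      by (intro prod.cong refl meas) auto
    then show "G \<phi> * (\<Prod>v\<in>?V. measure ?M {y\<in>space ?M. p y = \<phi> v}) = G \<phi> / card I ^ card ?V"
      by (simp add: power_divide)
  qed
  finally show ?thesis by (simp add: G_def sum_divide_distrib)
qed

text \<open>Everything factors through the finite set \<open>I \<times> I\<close>, on which all
  functions are measurable and bounded.\<close>

lemma coordinatewise_in_kernels:
  fixes p :: "real \<Rightarrow> nat \<Rightarrow> real"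
  assumes I: "finite I" and p: "p \<in> borel \<rightarrow>\<^sub>M count_space I"
  shows "(\<lambda>(x, y). Q (\<lambda>j. p x j * p y j)) \<in> kernels"
proof -
  let ?K = "\<lambda>(i, i'). Q (\<lambda>j. i j * i' j)" and ?W = "\<lambda>(x, y). Q (\<lambda>j. p x j * p y j)"
  have W: "?W = ?K \<circ> (\<lambda>z. (p (fst z), p (snd z)))" by auto
  have "(\<lambda>z. (p (fst z), p (snd z))) \<in> borel \<Otimes>\<^sub>M borel \<rightarrow>\<^sub>M count_space I \<Otimes>\<^sub>M count_space I"
    using p by measurable
  then have pp: "(\<lambda>z. (p (fst z), p (snd z))) \<in> borel \<Otimes>\<^sub>M borel \<rightarrow>\<^sub>M count_space (I \<times> I)"
    using I by (simp add: pair_measure_countable countable_finite)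
  have "?K \<in> borel_measurable (count_space (I \<times> I))" by simp
  then have "?W \<in> borel_measurable (borel \<Otimes>\<^sub>M borel)"
    unfolding W by (rule measurable_comp[OF pp])
  then have "?W \<in> borel_measurable lborel"
    by (simp add: borel_prod)
  then have "?W \<in> borel_measurable (lebesgue_on ({0..1} \<times> {0..1}))"
    by (intro measurable_restrict_space1 measurable_completion)
  moreover have "p x \<in> I" for x using measurable_space[OF p] by simp
  then have "range ?W \<subseteq> ?K ` (I \<times> I)" by auto
  then have "bounded (?W ` ({0..1} \<times> {0..1}))"
    using I by (meson bounded_subset finite_SigmaI finite_imageI finite_imp_bounded image_mono order_trans top_greatest)
  ultimately show ?thesis by (auto simp: kernels_def mult.commute)
qed

text \<open>The kernels \<open>\<Prod>j<n. 1 + a * r\<^sub>j(x) * r\<^sub>j(y)\<close> are \<open>n\<close>-th tensor powers, so every density below is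
  an \<open>n\<close>-th power; the factor \<open>2 ^ card (edges H)\<close> lost in the triangle inequality does not depend on
  \<open>n\<close> and disappears as \<open>n\<close> grows.\<close>

lemma weakly_norming_spin_average_le:
  fixes a b :: real
  assumes H: "simple_graph H" and wn: "weakly_norming H" and R: "R \<subseteq> edges H"
    and a: "\<bar>a\<bar> < 1" and b: "\<bar>b\<bar> < 1"
  shows "spin_average H (\<lambda>e. if e \<in> R then a else b) ^ card (edges H)
       \<le> spin_average H (\<lambda>_. a) ^ card R * spin_average H (\<lambda>_. b) ^ card (edges H - R)"
proof (cases "edges H = {}")
  case True
  then show ?thesis using R by simp
next
  case False
  let ?V = "verts H" and ?E = "edges H" and ?S = "{-1, 1 :: real}"
  define N where "N = card ?E"
  have fin: "finite ?V" "finite ?E" using simple_graph_finite[OF H] by auto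
  have N: "N > 0" using False fin by (simp add: N_def card_gt_0_iff)
  define za zb zm where "za = spin_average H (\<lambda>_. a)" and "zb = spin_average H (\<lambda>_. b)"
    and "zm = spin_average H (\<lambda>e. if e \<in> R then a else b)"
  have z: "za > 0" "zb > 0" "zm > 0"
    using spin_average_pos[OF H] a b by (auto simp: za_def zb_def zm_def)
  have bound: "(zm ^ N / (za ^ card R * zb ^ card (?E - R))) ^ n \<le> 2 ^ (N * N)" for n :: nat
  proof -
    \<comment> \<open>\<open>I\<close> consists of all sign vectors of length \<open>n\<close>;
      under a uniform \<open>p\<close> the coordinates are independent fair signs.\<close>
    define I where "I = PiE {..<n} (\<lambda>_. ?S)"
    have I: "finite I" "I \<noteq> {}" "card I = 2 ^ n"
      by (auto simp: I_def finite_PiE PiE_eq_empty_iff card_PiE numeral_2_eq_2)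
    obtain p :: "real \<Rightarrow> nat \<Rightarrow> real" where p: "range p \<subseteq> I" "p \<in> borel \<rightarrow>\<^sub>M count_space I"
      "\<And>i. i \<in> I \<Longrightarrow> measure lborel {x\<in>{0..1}. p x = i} = 1 / card I"
      using uniform_map_exists[OF I(1,2)] by metis
    \<comment> \<open>\<open>P c\<close> is the tensor power of the function 1 + c t of one sign,
      and \<open>D f\<close> is the density in which each edge \<open>e\<close> carries its own
      function \<open>f e\<close>.\<close>
    define P where "P c w = (\<Prod>j<n. 1 + c * w j)" for c :: real and w :: "nat \<Rightarrow> real"
    define K where "K Q = (\<lambda>(x, y). Q (\<lambda>j. p x j * p y j) :: real)" for Q
    define D where "D f = (\<Sum>\<phi>\<in>PiE ?V (\<lambda>_. I). \<Prod>e\<in>?E. f e (\<lambda>j. \<Prod>v\<in>e. \<phi> v j)) / card I ^ card ?V"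
      for f :: "'a set \<Rightarrow> (nat \<Rightarrow> real) \<Rightarrow> real"
    have hom: "hom_density H (K Q) = D (\<lambda>_. Q)" for Q
      unfolding K_def D_def by (rule hom_density_coordinatewise[OF H I(1) p(2,3)])
    have ker: "K Q \<in> kernels" for Q
      unfolding K_def by (rule coordinatewise_in_kernels[OF I(1) p(2)])
    have tensor: "D (\<lambda>e. P (c e)) = spin_average H c ^ n" for c
    proof -
      define g where "g s = (\<Prod>e\<in>?E. 1 + c e * (\<Prod>v\<in>e. s v))" for s :: "'a \<Rightarrow> real"
      have "(\<Prod>e\<in>?E. P (c e) (\<lambda>j. \<Prod>v\<in>e. \<phi> v j)) = (\<Prod>j<n. g (\<lambda>v\<in>?V. \<phi> v j))"
        for \<phi> :: "'a \<Rightarrow> nat \<Rightarrow> real"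
      proof -
        have "(\<Prod>v\<in>e. (\<lambda>v\<in>?V. \<phi> v j) v) = (\<Prod>v\<in>e. \<phi> v j)" if "e \<in> ?E" for e j
          using H that by (intro prod.cong) (auto simp: simple_graph_def)
        then have "g (\<lambda>v\<in>?V. \<phi> v j) = (\<Prod>e\<in>?E. 1 + c e * (\<Prod>v\<in>e. \<phi> v j))" for j
          unfolding g_def by (intro prod.cong refl) simp
        then show ?thesis unfolding P_def by (simp add: prod.swap[of _ ?E])
      qed
      then show ?thesis
        using sum_PiE_prod_power[OF fin(1), of "{..<n}" ?S g]
        by (simp add: D_def I_def[symmetric] I(3) spin_average_def g_def power_divide
            power_mult[symmetric] mult.commute)
    qed
    \<comment> \<open>\<open>P c\<close> can be negative at other real vectors, but every argument
      occurring in \<open>K\<close> or in \<open>D\<close> is a sign vector.\<close>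
    define signs where "signs w \<longleftrightarrow> (\<forall>j<n. w j \<in> ?S)" for w
    have signs_edge: "signs (\<lambda>j. \<Prod>v\<in>e. \<phi> v j)" if "\<phi> \<in> PiE ?V (\<lambda>_. I)" "e \<in> ?E" for \<phi> e
      unfolding signs_def
    proof (intro allI impI)
      fix j assume "j < n"
      have "\<phi> v j \<in> ?S" if "v \<in> e" for v
      proof -
        have "v \<in> ?V" using H \<open>e \<in> ?E\<close> that by (auto simp: simple_graph_def)
        then have "\<phi> v \<in> I" using \<open>\<phi> \<in> PiE ?V (\<lambda>_. I)\<close> by blast
        then show ?thesis using \<open>j < n\<close> unfolding I_def by blast
      qed
      then have "\<bar>\<Prod>v\<in>e. \<phi> v j\<bar> = 1" unfolding abs_prod by (intro prod.neutral) force
      then show "(\<Prod>v\<in>e. \<phi> v j) \<in> ?S" by auto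
    qed
    have Ppos: "P c w \<ge> 0" if "\<bar>c\<bar> < 1" "signs w" for c w
    proof -
      have "1 + c * w j \<ge> 0" if "j < n" for j
        using \<open>\<bar>c\<bar> < 1\<close> \<open>signs w\<close> that by (auto simp: signs_def)
      then show ?thesis unfolding P_def by (intro prod_nonneg) auto
    qed
    \<comment> \<open>These scalars normalise both kernels to norm 1, so the triangle inequality
      bounds the norm of their sum by 2.\<close>
    define \<alpha> \<beta> where "\<alpha> = root N (1 / za ^ n)" and "\<beta> = root N (1 / zb ^ n)"
    have \<alpha>\<beta>: "\<alpha> > 0" "\<beta> > 0" "\<alpha> ^ N = 1 / za ^ n" "\<beta> ^ N = 1 / zb ^ n"
      using N z by (auto simp: \<alpha>_def \<beta>_def real_root_pow_pos2)
    define U W where "U = (\<lambda>w. \<alpha> * P a w)" and "W = (\<lambda>w. \<beta> * P b w)"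
    have signs_p: "signs (\<lambda>j. p x j * p y j)" for x y
      unfolding signs_def
    proof (intro allI impI)
      fix j assume "j < n"
      then have "p x j \<in> ?S" "p y j \<in> ?S"
        using p(1) unfolding I_def by (blast dest: subsetD[OF _ rangeI])+
      then show "p x j * p y j \<in> ?S" by auto
    qed
    have scale: "D (\<lambda>e w. c e * Q e w) = (\<Prod>e\<in>?E. c e) * D Q" for c Q
      by (simp add: D_def prod.distrib sum_distrib_left)
    have nonneg: "U w \<ge> 0" "W w \<ge> 0" if "signs w" for w
      using Ppos[OF a that] Ppos[OF b that] \<alpha>\<beta> by (simp_all add: U_def W_def)
    have rn: "r_norm H (K Q) = D (\<lambda>_. Q) powr (1 / N)"
      if "\<And>w. signs w \<Longrightarrow> Q w \<ge> 0" for Q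
    proof -
      have "(\<lambda>z. \<bar>K Q z\<bar>) = K Q" using that signs_p by (auto simp: K_def fun_eq_iff)
      then show ?thesis by (simp add: r_norm_def hom N_def)
    qed
    have "D (\<lambda>_. U) = 1" "D (\<lambda>_. W) = 1"
      unfolding U_def W_def scale tensor using \<alpha>\<beta> z by (simp_all add: za_def zb_def N_def)
    then have UW: "r_norm H (K U) = 1" "r_norm H (K W) = 1"
      by (simp_all only: rn[OF nonneg(1)] rn[OF nonneg(2)] powr_one_eq_one)
    have "\<alpha> ^ card R * \<beta> ^ card (?E - R) * zm ^ n = D (\<lambda>e w. if e \<in> R then U w else W w)"
    proof -
      have "(\<Prod>e\<in>?E. if e \<in> R then \<alpha> else \<beta>) = \<alpha> ^ card R * \<beta> ^ card (?E - R)"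
        using fin R by (simp add: prod.If_cases Int_absorb1 Diff_eq)
      then have "\<alpha> ^ card R * \<beta> ^ card (?E - R) * zm ^ n
          = D (\<lambda>e w. (if e \<in> R then \<alpha> else \<beta>) * P (if e \<in> R then a else b) w)"
        unfolding scale tensor zm_def by simp
      also have "\<dots> = D (\<lambda>e w. if e \<in> R then U w else W w)"
        by (intro arg_cong[of _ _ D] ext) (simp add: U_def W_def)
      finally show ?thesis .
    qed
    \<comment> \<open>Each factor is one of two nonnegative summands; replacing it by their sum
      cannot decrease the product.\<close>
    also have "\<dots> \<le> D (\<lambda>_ w. U w + W w)"
      unfolding D_def
    proof (intro divide_right_mono sum_mono prod_mono conjI)
      fix \<phi> e assume "\<phi> \<in> PiE ?V (\<lambda>_. I)" "e \<in> ?E"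
      then have "U (\<lambda>j. \<Prod>v\<in>e. \<phi> v j) \<ge> 0" "W (\<lambda>j. \<Prod>v\<in>e. \<phi> v j) \<ge> 0"
        using signs_edge nonneg by blast+
      then show "0 \<le> (if e \<in> R then U (\<lambda>j. \<Prod>v\<in>e. \<phi> v j) else W (\<lambda>j. \<Prod>v\<in>e. \<phi> v j))"
        "(if e \<in> R then U (\<lambda>j. \<Prod>v\<in>e. \<phi> v j) else W (\<lambda>j. \<Prod>v\<in>e. \<phi> v j))
          \<le> U (\<lambda>j. \<Prod>v\<in>e. \<phi> v j) + W (\<lambda>j. \<Prod>v\<in>e. \<phi> v j)"
        by auto
    qed simp
    finally have lower: "\<alpha> ^ card R * \<beta> ^ card (?E - R) * zm ^ n \<le> D (\<lambda>_ w. U w + W w)" .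
    have Dpos: "D (\<lambda>_ w. U w + W w) \<ge> 0"
      using z \<alpha>\<beta> by (intro order_trans[OF _ lower]) simp
    have "r_norm H (K (\<lambda>w. U w + W w)) \<le> 2"
    proof -
      have "K (\<lambda>w. U w + W w) = (\<lambda>z. K U z + K W z)" by (auto simp: K_def)
      then show ?thesis using wn ker[of U] ker[of W] UW
        unfolding weakly_norming_def norm_on_kernels_def by (metis one_add_one)
    qed
    moreover have "r_norm H (K (\<lambda>w. U w + W w)) = root N (D (\<lambda>_ w. U w + W w))"
      using N Dpos by (subst rn) (auto intro!: add_nonneg_nonneg nonneg simp: root_powr_inverse)
    ultimately have "root N (D (\<lambda>_ w. U w + W w)) ^ N \<le> 2 ^ N"
      using Dpos N by (intro power_mono) auto
    then have "\<alpha> ^ card R * \<beta> ^ card (?E - R) * zm ^ n \<le> 2 ^ N"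
      using lower Dpos N by (simp add: real_root_pow_pos2)
    \<comment> \<open>The power \<open>N\<close> clears the roots in \<alpha> and \<beta>, leaving a
      pure \<open>n\<close>-th power.\<close>
    then have "(\<alpha> ^ card R * \<beta> ^ card (?E - R) * zm ^ n) ^ N \<le> (2 ^ N) ^ N"
      using z \<alpha>\<beta> by (intro power_mono) auto
    also have "(\<alpha> ^ card R * \<beta> ^ card (?E - R) * zm ^ n) ^ N
        = (\<alpha> ^ N) ^ card R * (\<beta> ^ N) ^ card (?E - R) * (zm ^ N) ^ n"
      by (simp add: power_mult_distrib power_mult[symmetric] mult.commute)
    also have "\<dots> = (zm ^ N / (za ^ card R * zb ^ card (?E - R))) ^ n"
      by (simp add: \<alpha>\<beta> power_divide power_mult_distrib power_mult[symmetric] mult.commute)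
    finally show ?thesis by (simp add: power_mult)
  qed
  \<comment> \<open>A base above 1 would have unbounded powers, against the bound uniform in
    \<open>n\<close>.\<close>
  have "zm ^ N / (za ^ card R * zb ^ card (?E - R)) \<le> 1"
    using bound real_arch_pow by (meson not_le)
  then show ?thesis using z by (simp add: zm_def za_def zb_def N_def divide_le_eq)
qed

section \<open>Even edge sets of the bowtie of a cycle\<close>

text \<open>A positive even degree is at least 2, so an even edge set has no vertex of degree
  one.\<close>

lemma even_edge_sets_other_edge:
  assumes "simple_graph H" "F \<in> even_edge_sets H" "e \<in> F" "v \<in> e"
  obtains e' where "e' \<in> F" "e' \<noteq> e" "v \<in> e'"
proof -
  have v: "v \<in> verts H" using assms by (auto simp: even_edge_sets_def simple_graph_def)
  have "even (card {e'\<in>F. v \<in> e'})" using assms(2) v by (simp add: even_edge_sets_def)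
  then have "card {e'\<in>F. v \<in> e'} \<noteq> card {e}" by force
  then have "{e'\<in>F. v \<in> e'} \<noteq> {e}" by metis
  moreover have "e \<in> {e'\<in>F. v \<in> e'}" using assms(3,4) by simp
  ultimately obtain e' where "e' \<in> {e'\<in>F. v \<in> e'}" "e' \<noteq> e" by blast
  then show ?thesis using that[of e'] by simp
qed

lemma empty_in_even_edge_sets: "{} \<in> even_edge_sets H"
  by (simp add: even_edge_sets_def)

lemma finite_even_edge_sets:
  assumes "simple_graph H"
  shows "finite (even_edge_sets H)"
proof (rule finite_subset)
  show "even_edge_sets H \<subseteq> Pow (edges H)" by (auto simp: even_edge_sets_def)
  show "finite (Pow (edges H))" using simple_graph_finite[OF assms] by simp
qed

text \<open>The bowtie is bipartite between first and second copies, so its edges are cells of a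
  grid: first copies are rows, second copies are columns, and the edges joining the two copies of a
  vertex lie on the diagonal.\<close>

definition cross_edge :: "nat \<Rightarrow> nat \<Rightarrow> (nat \<times> nat) set" where
  "cross_edge u v = {(u, 1), (v, 2)}"

text \<open>Closed neighbourhoods in the cycle; equality is included to account for the diagonal
  cells.\<close>

definition near :: "nat \<Rightarrow> nat \<Rightarrow> nat \<Rightarrow> bool" where
  "near k u v \<longleftrightarrow> u = v \<or> v = (u + 1) mod k \<or> u = (v + 1) mod k"

text \<open>The 4-cycle that the bowtie builds from the cycle edge at \<open>j\<close>, in the grid
  a two by two block.\<close>

definition square :: "nat \<Rightarrow> nat \<Rightarrow> (nat \<times> nat) set set" where
  "square k j = {cross_edge u v | u v. u \<in> {j, (j + 1) mod k} \<and> v \<in> {j, (j + 1) mod k}}"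

lemma cross_edge_eq_iff [simp]: "cross_edge u v = cross_edge u' v' \<longleftrightarrow> u = u' \<and> v = v'"
  by (auto simp: cross_edge_def doubleton_eq_iff)

lemma in_cross_edge [simp]:
  "(w, Suc 0) \<in> cross_edge u v \<longleftrightarrow> w = u" "(w, 2) \<in> cross_edge u v \<longleftrightarrow> w = v"
  by (auto simp: cross_edge_def)

lemma edges_bowtie_cycle:
  assumes "k > 0"
  shows "edges (bowtie (cycle_graph k)) = {cross_edge u v | u v. u < k \<and> v < k \<and> near k u v}"
proof -
  have "{u, v} \<in> edges (cycle_graph k) \<longleftrightarrow> u < k \<and> v < k \<and> (v = (u + 1) mod k \<or> u = (v + 1) mod k)" for u v
    using assms by (auto simp: cycle_graph_def doubleton_eq_iff)
  then show ?thesis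
    by (auto simp: bowtie_def cross_edge_def near_def cycle_graph_def)
qed

lemma succ_mod: "Suc u mod k = (if Suc u = k then 0 else Suc u)" if "u < k" for u k :: nat
  using that by auto

text \<open>The cells form three cyclic diagonals of length \<open>k\<close>; \<open>k > 2\<close>
  keeps the upper and the lower one disjoint.\<close>

lemma card_near:
  assumes "k > 2"
  shows "card {(u, v). u < k \<and> v < k \<and> near k u v} = 3 * k"
proof -
  let ?s = "\<lambda>u. (u + 1) mod k"
  let ?A = "(\<lambda>u. (u, u)) ` {..<k}" and ?B = "(\<lambda>u. (u, ?s u)) ` {..<k}" and ?C = "(\<lambda>u. (?s u, u)) ` {..<k}"
  have s: "?s u \<noteq> u" "?s (?s u) \<noteq> u" "?s u < k" if "u < k" for u
    using that assms by (auto simp: succ_mod)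
  have "{(u, v). u < k \<and> v < k \<and> near k u v} = ?A \<union> ?B \<union> ?C"
    using s by (auto simp: near_def)
  moreover have "?A \<inter> ?B = {}" "(?A \<union> ?B) \<inter> ?C = {}"
    using s by (auto dest: sym)
  ultimately have "card {(u, v). u < k \<and> v < k \<and> near k u v} = card ?A + card ?B + card ?C"
    by (simp add: card_Un_disjoint)
  also have "\<dots> = 3 * k"
    by (simp add: card_image inj_on_def)
  finally show ?thesis .
qed

lemma card_edges_bowtie_cycle:
  assumes "k > 2"
  shows "card (edges (bowtie (cycle_graph k))) = 3 * k"
proof -
  have "edges (bowtie (cycle_graph k)) = (\<lambda>(u, v). cross_edge u v) ` {(u, v). u < k \<and> v < k \<and> near k u v}"
    using assms by (auto simp: edges_bowtie_cycle)
  moreover have "inj (\<lambda>(u, v). cross_edge u v)" by (auto simp: inj_def)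
  ultimately show ?thesis
    using card_near[OF assms] by (simp add: card_image inj_on_subset[OF _ subset_UNIV])
qed

text \<open>Adjacent vertices of a cycle have no common neighbour once triangles are excluded, hence
  \<open>k > 3\<close>.\<close>

lemma near_succ:
  assumes "k > 3" "j < k" "v < k" "near k j v" "near k ((j + 1) mod k) v"
  shows "v = j \<or> v = (j + 1) mod k"
  using assms by (auto simp: near_def succ_mod split: if_splits)

text \<open>This is where \<open>k > 4\<close> is needed: opposite vertices of \<open>C\<^sub>4\<close> have two common neighbours.\<close>

lemma near_rectangle:
  assumes "k > 4" "u < k" "u' < k" "v < k" "v' < k" "u \<noteq> u'" "v \<noteq> v'"
    and "near k u v" "near k u v'" "near k u' v" "near k u' v'"
  obtains j where "j < k" "{u, u'} = {j, (j + 1) mod k}" "{v, v'} = {j, (j + 1) mod k}"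
proof -
  \<comment> \<open>At distance two the closed neighbourhoods of \<open>u\<close> and
    \<open>u'\<close> meet in one vertex only, which cannot serve as both \<open>v\<close> and
    \<open>v'\<close>; at larger distance they are disjoint.\<close>
  have "u' = (u + 1) mod k \<or> u = (u' + 1) mod k"
    using assms unfolding near_def by (auto simp: succ_mod split: if_splits)
  then obtain j j' where j: "j < k" "j' = (j + 1) mod k" "{u, u'} = {j, j'}"
    using assms by blast
  have "near k j v" "near k j' v" "near k j v'" "near k j' v'"
    using j(3) assms by (auto simp: doubleton_eq_iff)
  then have "v \<in> {j, j'}" "v' \<in> {j, j'}"
    using near_succ[of k j] assms(1,4,5) j(1,2) by auto
  then have "{v, v'} = {j, j'}" using assms(7) by auto
  then show ?thesis using that j by simp
qed

text \<open>No row or column of the grid holds exactly one cell of \<open>F\<close>. So a nonempty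
  \<open>F\<close> has at least four cells, and four of them must form a rectangle.\<close>

lemma small_even_edge_sets:
  assumes k: "k > 4" and F: "F \<in> even_edge_sets (bowtie (cycle_graph k))" and "card F \<le> 4" "F \<noteq> {}"
  obtains j where "j < k" "F = square k j"
proof -
  let ?H = "bowtie (cycle_graph k)"
  have H: "simple_graph ?H" using k by (intro simple_graph_bowtie simple_graph_cycle_graph) simp
  have sub: "F \<subseteq> edges ?H" using F by (simp add: even_edge_sets_def)
  then have fin: "finite F" using simple_graph_finite[OF H] finite_subset by auto
  have cross: "\<exists>u v. e = cross_edge u v \<and> u < k \<and> v < k \<and> near k u v" if "e \<in> F" for e
    using that sub k by (auto simp: edges_bowtie_cycle)
  have row: "\<exists>v'. v' \<noteq> v \<and> cross_edge u v' \<in> F" if "cross_edge u v \<in> F" for u v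
    using even_edge_sets_other_edge[OF H F that, of "(u, Suc 0)"] cross by (metis in_cross_edge(1))
  have col: "\<exists>u'. u' \<noteq> u \<and> cross_edge u' v \<in> F" if "cross_edge u v \<in> F" for u v
    using even_edge_sets_other_edge[OF H F that, of "(v, 2)"] cross by (metis in_cross_edge(2))
  \<comment> \<open>Row and column moves from one cell reach four distinct cells; the size bound
    makes them all of \<open>F\<close>.\<close>
  obtain u v where uv: "cross_edge u v \<in> F" using \<open>F \<noteq> {}\<close> cross by blast
  obtain v' where v': "v' \<noteq> v" "cross_edge u v' \<in> F" using row uv by blast
  obtain u' where u': "u' \<noteq> u" "cross_edge u' v \<in> F" using col uv by blast
  obtain w where w: "w \<noteq> u" "cross_edge w v' \<in> F" using col v'(2) by blast
  let ?G = "{cross_edge u v, cross_edge u v', cross_edge u' v, cross_edge w v'}"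
  have "card ?G = 4" using v' u' w by auto
  then have FG: "F = ?G" using uv v' u' w fin \<open>card F \<le> 4\<close>
    by (intro card_seteq[symmetric]) auto
  \<comment> \<open>Row \<open>u'\<close> needs a second cell, and only the one in column
    \<open>v'\<close> is available; this closes the rectangle.\<close>
  obtain x where x: "x \<noteq> v" "cross_edge u' x \<in> F" using row u'(2) by blast
  then have "w = u'" using FG u' by auto
  then have G: "F = {cross_edge u v, cross_edge u v', cross_edge u' v, cross_edge u' v'}"
    using FG by simp
  have "u < k \<and> v < k \<and> near k u v" "u < k \<and> v' < k \<and> near k u v'"
    "u' < k \<and> v < k \<and> near k u' v" "u' < k \<and> v' < k \<and> near k u' v'"
    using cross[OF uv] cross[OF v'(2)] cross[OF u'(2)] cross[OF w(2)] \<open>w = u'\<close> by auto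
  then obtain j where j: "j < k" "{u, u'} = {j, (j + 1) mod k}" "{v, v'} = {j, (j + 1) mod k}"
    using near_rectangle[OF k, of u u' v v'] u'(1) v'(1) by metis
  have "F = {cross_edge x y | x y. x \<in> {u, u'} \<and> y \<in> {v, v'}}"
    unfolding G by blast
  then show ?thesis using that[OF j(1)] unfolding square_def j(2,3) by simp
qed

lemma square_eq:
  "square k j = {cross_edge j j, cross_edge ((j + 1) mod k) ((j + 1) mod k),
     cross_edge j ((j + 1) mod k), cross_edge ((j + 1) mod k) j}"
  unfolding square_def by blast

lemma square_in_even_edge_sets:
  assumes "k > 2" "j < k"
  shows "square k j \<in> even_edge_sets (bowtie (cycle_graph k))"
proof -
  define s where "s = (j + 1) mod k"
  have s: "s \<noteq> j" "s < k" using assms by (auto simp: s_def succ_mod)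
  have sq: "square k j = {cross_edge j j, cross_edge s s, cross_edge j s, cross_edge s j}"
    by (simp only: square_eq s_def)
  have near: "near k j s" "near k s j" "near k j j" "near k s s" by (simp_all add: near_def s_def)
  have "square k j \<subseteq> edges (bowtie (cycle_graph k))"
    using assms s near unfolding sq by (auto simp: edges_bowtie_cycle)
  moreover have "even (card {e\<in>square k j. x \<in> e})" if x': "x \<in> verts (bowtie (cycle_graph k))" for x
  proof -
    obtain w i where x: "x = (w, i)" "i = 1 \<or> i = 2" using x' by (auto simp: bowtie_def)
    \<comment> \<open>Row \<open>w\<close> and column \<open>w\<close> each meet the block in two
      cells or in none.\<close>
    have "{e\<in>square k j. (w, 1) \<in> e} = (if w = j \<or> w = s then {cross_edge w j, cross_edge w s} else {})"
      "{e\<in>square k j. (w, 2) \<in> e} = (if w = j \<or> w = s then {cross_edge j w, cross_edge s w} else {})"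
      using s(1) unfolding sq by auto
    then show ?thesis using x s(1) by auto
  qed
  ultimately show ?thesis by (simp add: even_edge_sets_def)
qed

text \<open>The off-diagonal cells of a square reveal its cycle edge, and for \<open>k > 2\<close>
  distinct \<open>j\<close> give distinct cycle edges; for \<open>k = 2\<close> both squares
  coincide.\<close>

lemma inj_on_square:
  assumes "k > 2"
  shows "inj_on (square k) {..<k}"
proof (rule inj_onI)
  fix i j assume ij: "i \<in> {..<k}" "j \<in> {..<k}" "square k i = square k j"
  have "cross_edge i ((i + 1) mod k) \<in> square k j" "cross_edge ((i + 1) mod k) i \<in> square k j"
    unfolding ij(3)[symmetric] by (auto simp: square_eq)
  then show "i = j" using assms ij(1,2)
    by (auto simp: square_eq succ_mod split: if_splits)
qed

section \<open>Bounds on spin averages of the bowtie of a cycle\<close>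

definition rungs :: "nat \<Rightarrow> (nat \<times> nat) set set" where
  "rungs k = {cross_edge v v | v. v < k}"

lemma rungs_subset: "rungs k \<subseteq> edges (bowtie (cycle_graph k))"
  by (auto simp: rungs_def bowtie_def cycle_graph_def cross_edge_def)

lemma card_rungs: "card (rungs k) = k"
proof -
  have "rungs k = (\<lambda>v. cross_edge v v) ` {..<k}" by (auto simp: rungs_def)
  then show ?thesis by (simp add: card_image inj_on_def)
qed

lemma prod_square:
  fixes a b :: real
  assumes "k > 2" "j < k"
  shows "(\<Prod>e\<in>square k j. if e \<in> rungs k then a else b) = a\<^sup>2 * b\<^sup>2"
proof -
  have s: "(j + 1) mod k \<noteq> j" "(j + 1) mod k < k" using assms by (auto simp: succ_mod)
  then show ?thesis using assms(2) by (auto simp: square_eq rungs_def power2_eq_square)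
qed

text \<open>All terms of the expansion are nonnegative; only the empty set and the \<open>k\<close>
  squares are kept.\<close>

lemma spin_average_rungs_ge:
  assumes "k > 2" "a \<ge> 0" "b \<ge> 0"
  shows "spin_average (bowtie (cycle_graph k)) (\<lambda>e. if e \<in> rungs k then a else b) \<ge> 1 + k * (a\<^sup>2 * b\<^sup>2)"
proof -
  let ?H = "bowtie (cycle_graph k)" and ?c = "\<lambda>e. if e \<in> rungs k then a else b"
  have H: "simple_graph ?H" using assms by (intro simple_graph_bowtie simple_graph_cycle_graph) simp
  have ne: "{} \<notin> square k ` {..<k}" by (auto simp: square_eq)
  have "1 + k * (a\<^sup>2 * b\<^sup>2) = (\<Sum>F\<in>insert {} (square k ` {..<k}). \<Prod>e\<in>F. ?c e)"
    using ne inj_on_square[OF assms(1)] prod_square[OF assms(1)] by (simp add: sum.reindex)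
  also have "\<dots> \<le> (\<Sum>F\<in>even_edge_sets ?H. \<Prod>e\<in>F. ?c e)"
  proof (rule sum_mono2[OF finite_even_edge_sets[OF H]])
    show "insert {} (square k ` {..<k}) \<subseteq> even_edge_sets ?H"
      using square_in_even_edge_sets[OF assms(1)] empty_in_even_edge_sets[of ?H] by auto
  qed (use assms in \<open>auto intro: prod_nonneg\<close>)
  finally show ?thesis by (simp add: spin_average_eq_sum_even_edge_sets[OF H])
qed

text \<open>With 3k edges there are at most 8^k even edge sets, and those other than the empty set
  and the squares have at least five edges.\<close>

lemma spin_average_const_le:
  assumes k: "k > 4" and a: "0 \<le> a" "a \<le> 1"
  shows "spin_average (bowtie (cycle_graph k)) (\<lambda>_. a) \<le> 1 + k * a ^ 4 + 8 ^ k * a ^ 5"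
proof -
  let ?H = "bowtie (cycle_graph k)"
  have H: "simple_graph ?H" using k by (intro simple_graph_bowtie simple_graph_cycle_graph) simp
  have finE: "finite (edges ?H)" using simple_graph_finite[OF H] by simp
  have sub: "even_edge_sets ?H \<subseteq> Pow (edges ?H)" by (auto simp: even_edge_sets_def)
  have fin: "finite (even_edge_sets ?H)" by (rule finite_even_edge_sets[OF H])
  have card: "card (even_edge_sets ?H) \<le> 8 ^ k"
    using card_mono[OF _ sub] finE card_edges_bowtie_cycle[of k] k by (simp add: card_Pow power_mult)
  let ?S = "insert {} (square k ` {..<k})"
  have S: "?S \<subseteq> even_edge_sets ?H"
    using square_in_even_edge_sets[of k] empty_in_even_edge_sets[of ?H] k
    by (simp add: image_subset_iff)
  have "spin_average ?H (\<lambda>_. a) = (\<Sum>F\<in>even_edge_sets ?H. a ^ card F)"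
    by (simp add: spin_average_eq_sum_even_edge_sets[OF H])
  also have "\<dots> = (\<Sum>F\<in>?S. a ^ card F) + (\<Sum>F\<in>even_edge_sets ?H - ?S. a ^ card F)"
    using sum.subset_diff[OF S fin] by (simp add: add.commute)
  also have "(\<Sum>F\<in>?S. a ^ card F) = 1 + k * a ^ 4"
  proof -
    have "{} \<notin> square k ` {..<k}" by (auto simp: square_eq)
    \<comment> \<open>The size 4 of a square is extracted from \<open>prod_square\<close> by making
      both weights equal.\<close>
    moreover have "a ^ card (square k j) = a ^ 4" if "j < k" for j
      using prod_square[of k j a a] k that by (simp add: power_add[symmetric])
    ultimately show ?thesis
      using inj_on_square[of k] k by (simp add: sum.reindex)
  qed
  also have "(\<Sum>F\<in>even_edge_sets ?H - ?S. a ^ card F) \<le> 8 ^ k * a ^ 5"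
  proof -
    have "a ^ card F \<le> a ^ 5" if F: "F \<in> even_edge_sets ?H - ?S" for F
    proof -
      have "\<not> card F \<le> 4" using small_even_edge_sets[OF k, of F] F by blast
      then show ?thesis using a by (intro power_decreasing) auto
    qed
    then have "(\<Sum>F\<in>even_edge_sets ?H - ?S. a ^ card F) \<le> card (even_edge_sets ?H - ?S) * a ^ 5"
      by (rule sum_bounded_above)
    also have "\<dots> \<le> 8 ^ k * a ^ 5"
    proof (rule mult_right_mono)
      have "card (even_edge_sets ?H - ?S) \<le> 8 ^ k"
        by (rule order_trans[OF card_mono[OF fin Diff_subset] card])
      then have "real (card (even_edge_sets ?H - ?S)) \<le> real (8 ^ k)"
        by (rule of_nat_mono)
      then show "real (card (even_edge_sets ?H - ?S)) \<le> 8 ^ k"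
        by simp
    qed (use a in simp)
    finally show ?thesis .
  qed
  finally show ?thesis by simp
qed

section \<open>Contradiction from edge weights in the ratio 4 to 3\<close>

theorem theorem1p4:
  fixes k :: nat
  assumes "k > 4"
  shows "\<not> weakly_norming (bowtie (cycle_graph k))"
proof
  let ?H = "bowtie (cycle_graph k)"
  assume wn: "weakly_norming ?H"
  have H: "simple_graph ?H" using assms by (intro simple_graph_bowtie simple_graph_cycle_graph) simp
  \<comment> \<open>Here 1024 is 4^5, so that the error 8^k (4 \<epsilon>)^5 equals
    \<epsilon>^4.\<close>
  define \<epsilon> :: real where "\<epsilon> = 1 / (1024 * 8 ^ k)"
  have \<epsilon>: "\<epsilon> > 0" "8 ^ k * \<epsilon> = 1 / 1024" by (auto simp: \<epsilon>_def)
  have k8: "real k \<le> 8 ^ k"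
    using of_nat_mono[OF less_imp_le[OF power_gt_expt[of 8 k]], where 'a = real] by simp
  have \<epsilon>1: "\<epsilon> \<le> 1 / 1024" unfolding \<epsilon>_def by (simp add: field_simps)
  \<comment> \<open>The common unit of the leading terms: \<open>k\<close> squares, each weighing a
    constant times \<epsilon>^4.\<close>
  define x where "x = k * \<epsilon> ^ 4"
  have x0: "x > 0" using assms \<epsilon> by (simp add: x_def)
  have x1: "x \<le> 1 / 10000"
  proof -
    have "x = (k * \<epsilon>) * \<epsilon> ^ 3" by (simp add: x_def power_numeral_reduce)
    also have "\<dots> \<le> (8 ^ k * \<epsilon>) * (1 / 1024) ^ 3"
      using \<epsilon> \<epsilon>1 k8 by (intro mult_mono power_mono) auto
    finally show ?thesis by (simp add: \<epsilon>(2) power_numeral_reduce)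
  qed
  \<comment> \<open>A square weighs 16 * 9 = 144 when mixed and 256 or 81 when pure, in units of
    \<epsilon>^4; the violation comes from 3 * 144 = 432 > 418 = 256 + 2 * 81.\<close>
  define zm za zb where "zm = spin_average ?H (\<lambda>e. if e \<in> rungs k then 4 * \<epsilon> else 3 * \<epsilon>)"
    and "za = spin_average ?H (\<lambda>_. 4 * \<epsilon>)" and "zb = spin_average ?H (\<lambda>_. 3 * \<epsilon>)"
  have z0: "za > 0" "zb > 0" "zm > 0"
    using spin_average_pos[OF H] \<epsilon>(1) \<epsilon>1 by (auto simp: zm_def za_def zb_def)
  have zm: "1 + 144 * x \<le> zm"
    using spin_average_rungs_ge[of k "4 * \<epsilon>" "3 * \<epsilon>"] assms \<epsilon>
    by (simp add: zm_def x_def power_numeral_reduce mult_ac)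
  have small: "8 ^ k * (c * \<epsilon>) ^ 5 \<le> x" if "0 \<le> c" "c \<le> 4" for c
  proof -
    have "8 ^ k * (c * \<epsilon>) ^ 5 = c ^ 5 * (8 ^ k * \<epsilon>) * \<epsilon> ^ 4"
      by (simp add: power_numeral_reduce mult_ac)
    also have "\<dots> \<le> 4 ^ 5 * (8 ^ k * \<epsilon>) * \<epsilon> ^ 4"
      using that \<epsilon> by (intro mult_right_mono power_mono) auto
    also have "\<dots> = \<epsilon> ^ 4" by (simp add: \<epsilon>(2))
    also have "\<dots> \<le> x" using assms \<epsilon> by (simp add: x_def)
    finally show ?thesis .
  qed
  \<comment> \<open>The coefficients 257 here and 82 below are 4^4 and 3^4 plus 1, the extra 1
    absorbing the error term.\<close>
  have za: "za \<le> 1 + 257 * x"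
    using spin_average_const_le[OF assms, of "4 * \<epsilon>"] small[of 4] \<epsilon>(1) \<epsilon>1
    by (simp add: za_def x_def power_mult_distrib mult_ac)
  have zb: "zb \<le> 1 + 82 * x"
    using spin_average_const_le[OF assms, of "3 * \<epsilon>"] small[of 3] \<epsilon>(1) \<epsilon>1
    by (simp add: zb_def x_def power_mult_distrib mult_ac)
  have "card (edges ?H - rungs k) = 2 * k"
    using card_Diff_subset[OF _ rungs_subset] finite_subset[OF rungs_subset simple_graph_finite(2)[OF H]]
      card_edges_bowtie_cycle[of k] assms by (simp add: card_rungs)
  then have "zm ^ (3 * k) \<le> za ^ k * zb ^ (2 * k)"
    using weakly_norming_spin_average_le[OF H wn rungs_subset, of "4 * \<epsilon>" "3 * \<epsilon>"] \<epsilon>(1) \<epsilon>1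
      card_edges_bowtie_cycle[of k] assms
    by (simp add: card_rungs zm_def za_def zb_def)
  \<comment> \<open>Rungs make up k of the 3k edges, so a k-th root leaves an inequality with fixed
    exponents.\<close>
  then have "(zm ^ 3) ^ k \<le> (za * zb ^ 2) ^ k"
    by (simp add: power_mult power_mult_distrib)
  then have "zm ^ 3 \<le> za * zb ^ 2"
    using assms z0 by (simp add: power_mono_iff)
  also have "\<dots> \<le> (1 + 257 * x) * (1 + 82 * x) ^ 2"
    using za zb z0 by (intro mult_mono power_mono) auto
  \<comment> \<open>The linear coefficient 257 + 2 * 82 = 421 is 11 below 432, and the higher terms
    cost at most 10 because \<open>x\<close> is tiny.\<close>
  also have "\<dots> = 1 + 421 * x + x * (48872 * x + 1728068 * (x * x))"
    by (simp add: power2_eq_square algebra_simps)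
  also have "\<dots> \<le> 1 + 421 * x + x * 10"
  proof -
    have "x * x \<le> 1 / 10000 * (1 / 10000)" using x0 x1 by (intro mult_mono) auto
    then have "48872 * x + 1728068 * (x * x) \<le> 10" using x1 by simp
    then show ?thesis using x0 by (intro add_left_mono mult_left_mono) auto
  qed
  also have "\<dots> < 1 + 432 * x" using x0 by simp
  also have "\<dots> \<le> (1 + 144 * x) ^ 3"
    using x0 by (simp add: power3_eq_cube algebra_simps)
  also have "\<dots> \<le> zm ^ 3" using zm x0 by (intro power_mono) auto
  finally show False by simp
qed

end
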